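(* Let $n\ge 1$, let $\bm{a}\in\mathbb{R}^n$ and let $\bm{s}=\mathrm{Softmax}(\bm{a})\in\mathbb{R}^n$. Let $z=F(\bm{s})$ be a real-valued differentiable function of the attention weights, so that $z$ is also a function of $\bm{a}$ through $z=F(\mathrm{Softmax}(\bm{a}))$. Put $g_k=\frac{\partial z}{\partial \bm{s}_k}$, evaluated at $\bm{s}=\mathrm{Softmax}(\bm{a})$, for $k=1,\dots,n$. Let $\epsilon>0$, let $\mathcal{I}_\epsilon=\{k:\bm{s}_k>\epsilon\}$, and let $\mathcal{I}_\epsilon^c=\{1,\dots,n\}\setminus\mathcal{I}_\epsilon$. Assume that $g_j=g_k$ for every $j,k\in\mathcal{I}_\epsilon$. Then for every $j\in\mathcal{I}_\epsilon$, \[ \left|\frac{\partial z}{\partial \bm{a}_j}\right|\;\le\;\epsilon\,\bm{s}_j\sum_{k\in\mathcal{I}_\epsilon^c}|g_j-g_k| . \]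
   Context: For $\bm{a}\in\mathbb{R}^n$ (the "attention scores"), $\mathrm{Softmax}(\bm{a})\in\mathbb{R}^n$ (the "attention weights") is the vector with entries $\mathrm{Softmax}(\bm{a})_j=\frac{e^{a_j}}{\sum_{k=1}^n e^{a_k}}$, i.e. the softmax with temperature $\tau=1$. The function $F$ is a real-valued function defined on an open subset of $\mathbb{R}^n$ containing all vectors of the form $\mathrm{Softmax}(\bm{a})$, and it is (Fréchet) differentiable there; it represents the dependence of a model output logit $z$ on the attention weights. The quantity $g_k=\partial z/\partial \bm{s}_k$ is the $k$-th partial derivative of $F$ at $\bm{s}$, with the entries of $\bm{s}$ treated as independent variables. The quantity $\partial z/\partial \bm{a}_j$ is the $j$-th partial derivative of the composite map $\bm{a}\mapsto F(\mathrm{Softmax}(\bm{a}))$ at $\bm{a}$. *)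

theory Defs
  imports "HOL-Analysis.Analysis"
begin

definition softmax :: "real ^ 'n \<Rightarrow> real ^ 'n" where
  "softmax a = (\<chi> j. exp (a $ j) / (\<Sum>k\<in>UNIV. exp (a $ k)))"

text \<open>
  The partial derivative is the ordinary derivative along the \<open>j\<close>-th coordinate line, so it depends
  only on the values of \<open>f\<close> near \<open>x\<close>. As with \<^const>\<open>deriv\<close>, the value is meaningful only where that
  derivative exists; the lemma below covers every point of Frechet differentiability.
\<close>

definition partial_deriv :: "(real ^ 'n \<Rightarrow> real) \<Rightarrow> 'n \<Rightarrow> real ^ 'n \<Rightarrow> real" where
  "partial_deriv f j x = deriv (\<lambda>t. f (x + t *\<^sub>R axis j 1)) 0"

lemma has_real_derivative_partial_deriv:
  fixes f :: "real ^ 'n \<Rightarrow> real"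
  assumes "f differentiable (at x)"
  shows "((\<lambda>t. f (x + t *\<^sub>R axis j 1)) has_real_derivative partial_deriv f j x) (at 0)"
proof -
  have line: "((\<lambda>t::real. x + t *\<^sub>R axis j 1) has_derivative (\<lambda>t. t *\<^sub>R axis j 1)) (at 0)"
    by (auto intro!: derivative_eq_intros)
  have "(f has_derivative frechet_derivative f (at x)) (at (x + 0 *\<^sub>R axis j 1))"
    using assms by (simp add: frechet_derivative_works)
  from has_derivative_compose[OF line this]
  have "(\<lambda>t::real. f (x + t *\<^sub>R axis j 1)) differentiable (at 0)"
    by (auto simp: differentiable_def)
  then show ?thesis
    unfolding partial_deriv_def
    by (metis DERIV_imp_deriv real_differentiable_def)
qed

end

theory Submission
  imports Defs
begin

text \<open>
  Since \<open>\<partial>s\<^sub>k / \<partial>a\<^sub>j = s\<^sub>k (\<delta>\<^sub>k\<^sub>j - s\<^sub>j)\<close> and the weights sum to 1, the chain rule gives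
  \<open>\<partial>z / \<partial>a\<^sub>j = s\<^sub>j \<Sum>\<^sub>k s\<^sub>k (g\<^sub>j - g\<^sub>k)\<close>. The terms with \<open>k \<in> I\<close> vanish, and \<open>0 < s\<^sub>k \<le> \<epsilon>\<close> in the others.
\<close>

lemma softmax_nth: "softmax a $ j = exp (a $ j) / (\<Sum>k\<in>UNIV. exp (a $ k))"
  by (simp add: softmax_def)

lemma sum_exp_pos: "(\<Sum>k\<in>UNIV. exp (a $ k)) > (0::real)" for a :: "real ^ 'n"
  by (rule sum_pos) auto

lemma softmax_pos: "softmax a $ j > 0"
  by (simp add: softmax_nth sum_exp_pos)

lemma sum_softmax: "(\<Sum>k\<in>UNIV. softmax a $ k) = 1"
  using sum_exp_pos[of a] by (simp add: softmax_nth flip: sum_divide_distrib)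

text \<open>By linearity \<open>D\<close> is determined by its values on the vectors
  \<open>axis k 1\<close>, and composing \<open>f\<close> with the k-th coordinate line identifies
  each such value with the derivative defining \<open>partial_deriv f k x\<close>. This brings the
  quantities g_k into the chain rule.\<close>

lemma has_derivative_eq_sum_partial_deriv:
  fixes f :: "real ^ 'n \<Rightarrow> real"
  assumes "(f has_derivative D) (at x)"
  shows "D v = (\<Sum>k\<in>UNIV. v $ k * partial_deriv f k x)"
proof -
  interpret D: linear D
    using assms by (rule has_derivative_linear)
  have "D (axis k 1) = partial_deriv f k x" for k
  proof -
    have "((\<lambda>t::real. x + t *\<^sub>R axis k 1) has_derivative (\<lambda>t. t *\<^sub>R axis k 1)) (at 0)"
      by (auto intro!: derivative_eq_intros)
    moreover have "(f has_derivative D) (at (x + 0 *\<^sub>R axis k 1))"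
      using assms by simp
    ultimately have "((\<lambda>t. f (x + t *\<^sub>R axis k 1)) has_derivative (\<lambda>t. D (t *\<^sub>R axis k 1))) (at 0)"
      by (rule has_derivative_compose)
    then have "((\<lambda>t. f (x + t *\<^sub>R axis k 1)) has_real_derivative D (axis k 1)) (at 0)"
      by (simp add: has_field_derivative_def D.scaleR mult_commute_abs)
    then show ?thesis
      by (simp add: partial_deriv_def DERIV_imp_deriv)
  qed
  moreover have "D v = D (\<Sum>k\<in>UNIV. v $ k *\<^sub>R axis k 1)"
    using basis_expansion[of v] by (simp add: scalar_mult_eq_scaleR)
  ultimately show ?thesis
    by (simp add: D.sum D.scaleR)
qed

text \<open>This is the j-th column of the Jacobian of \<open>softmax\<close>, obtained from the
  quotient rule in each coordinate. It is stated along a coordinate line because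
  \<open>partial_deriv\<close> differentiates along one.\<close>

lemma has_vector_derivative_softmax_axis:
  "((\<lambda>t. softmax (a + t *\<^sub>R axis j 1)) has_vector_derivative
     (\<chi> k. softmax a $ k * ((if k = j then 1 else 0) - softmax a $ j))) (at 0)"
  (is "(?f has_vector_derivative ?d) _")
proof -
  have exp_deriv: "((\<lambda>t. exp ((a + t *\<^sub>R axis j 1) $ k)) has_real_derivative
      exp (a $ k) * (if k = j then 1 else 0)) (at 0)" for k
    by (auto intro!: derivative_eq_intros simp: axis_def)
  have sum_deriv: "((\<lambda>t. \<Sum>i\<in>UNIV. exp ((a + t *\<^sub>R axis j 1) $ i)) has_real_derivative
      exp (a $ j)) (at 0)"
    \<comment> \<open>Moving along \<open>axis j 1\<close> changes only the j-th exponential, so a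
      single summand survives.\<close>
    by (rule DERIV_cong[OF DERIV_sum[OF exp_deriv]]) (simp add: if_distrib cong: if_cong)
  have "((\<lambda>t. ?f t $ k) has_real_derivative ?d $ k) (at 0)" for k
    unfolding softmax_nth using sum_exp_pos[of a]
    by (intro DERIV_cong[OF DERIV_divide[OF exp_deriv sum_deriv]])
      (auto simp: softmax_nth field_simps)
  \<comment> \<open>The basis vectors are the \<open>axis k 1\<close>, so inner products with them
    are coordinates; this is the form in which a derivative can be assembled componentwise.\<close>
  then have "((\<lambda>t. ?f t \<bullet> b) has_derivative (\<lambda>t. (t *\<^sub>R ?d) \<bullet> b)) (at 0)"
    if "b \<in> Basis" for b
    using that
    by (auto simp: Basis_vec_def cart_eq_inner_axis[symmetric] has_field_derivative_def
        mult_commute_abs inner_axis)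
  then show ?thesis
    unfolding has_vector_derivative_def
    by (subst has_derivative_componentwise_within) auto
qed

lemma partial_deriv_softmax_comp:
  fixes F :: "real ^ 'n \<Rightarrow> real" and a :: "real ^ 'n"
  assumes "F differentiable (at (softmax a))"
  shows "partial_deriv (\<lambda>x. F (softmax x)) j a =
    softmax a $ j * (\<Sum>k\<in>UNIV. softmax a $ k *
      (partial_deriv F j (softmax a) - partial_deriv F k (softmax a)))"
proof -
  define s where "s = softmax a"
  define g where "g k = partial_deriv F k s" for k
  obtain D where D: "(F has_derivative D) (at s)"
    using assms unfolding differentiable_def s_def by blast
  let ?v = "\<chi> k. s $ k * ((if k = j then 1 else 0) - s $ j)"
  \<comment> \<open>The curve passes through \<open>s\<close> at time 0 with velocity
    \<open>?v\<close>, so the chain rule needs differentiability of \<open>F\<close> only at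
    \<open>s\<close>.\<close>
  have "((\<lambda>t. F (softmax (a + t *\<^sub>R axis j 1))) has_derivative (\<lambda>t. D (t *\<^sub>R ?v))) (at 0)"
    using has_derivative_compose[OF
        has_vector_derivative_softmax_axis[of a j, unfolded has_vector_derivative_def]] D
    by (simp add: s_def)
  then have "((\<lambda>t. F (softmax (a + t *\<^sub>R axis j 1))) has_real_derivative D ?v) (at 0)"
    by (simp add: has_field_derivative_def linear_scale[OF has_derivative_linear[OF D]]
        mult_commute_abs)
  then have "partial_deriv (\<lambda>x. F (softmax x)) j a = D ?v"
    by (simp add: partial_deriv_def DERIV_imp_deriv)
  also have "\<dots> = (\<Sum>k\<in>UNIV. (if k = j then s $ j * g j else 0) - s $ j * (s $ k * g k))"
    unfolding has_derivative_eq_sum_partial_deriv[OF D] g_def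
    by (intro sum.cong) (auto simp: algebra_simps)
  \<comment> \<open>The factor \<open>\<Sum>k\<in>UNIV. s $ k\<close>, equal to 1, is inserted so
    that \<open>g j\<close> can be distributed over the sum and paired with each
    \<open>g k\<close>.\<close>
  also have "\<dots> = s $ j * (g j * (\<Sum>k\<in>UNIV. s $ k) - (\<Sum>k\<in>UNIV. s $ k * g k))"
    by (simp add: sum_subtractf sum_softmax s_def right_diff_distrib flip: sum_distrib_left)
  also have "\<dots> = s $ j * (\<Sum>k\<in>UNIV. s $ k * (g j - g k))"
    by (simp add: sum_distrib_left sum_subtractf right_diff_distrib mult.commute)
  finally show ?thesis
    by (simp add: s_def g_def)
qed

theorem proposition3p1:
  fixes a s g :: "real ^ 'n"
    and F :: "real ^ 'n \<Rightarrow> real"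
    and U :: "(real ^ 'n) set"
    and \<epsilon> :: real
    and I :: "'n set"
  assumes "open U"
    and "range softmax \<subseteq> U"
    and "F differentiable_on U"
    and "s = softmax a"
    and "g = (\<chi> k. partial_deriv F k s)"
    and "\<epsilon> > 0"
    and "I = {k. s $ k > \<epsilon>}"
    and "\<forall>j\<in>I. \<forall>k\<in>I. g $ j = g $ k"
  shows "\<forall>j\<in>I. \<bar>partial_deriv (\<lambda>x. F (softmax x)) j a\<bar>
                 \<le> \<epsilon> * s $ j * (\<Sum>k\<in>- I. \<bar>g $ j - g $ k\<bar>)"
proof
  fix j assume "j \<in> I"
  \<comment> \<open>Openness of \<open>U\<close> turns differentiability within \<open>U\<close>
    into differentiability at the point.\<close>
  have "F differentiable (at (softmax a))"
    using assms(1-3) by (meson differentiable_on_eq_differentiable_at rangeI subsetD)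
  then have "partial_deriv (\<lambda>x. F (softmax x)) j a
      = s $ j * (\<Sum>k\<in>UNIV. s $ k * (g $ j - g $ k))"
    using assms(4,5) by (simp add: partial_deriv_softmax_comp)
  also have "(\<Sum>k\<in>UNIV. s $ k * (g $ j - g $ k)) = (\<Sum>k\<in>- I. s $ k * (g $ j - g $ k))"
  proof (rule sum.mono_neutral_right)
    \<comment> \<open>The index set here is \<open>I\<close> itself, on which \<open>g\<close> is
      constant.\<close>
    show "\<forall>k\<in>UNIV - - I. s $ k * (g $ j - g $ k) = 0"
      using \<open>j \<in> I\<close> assms(8) by (metis Compl_iff DiffD2 diff_self mult_zero_right)
  qed simp_all
  finally have "\<bar>partial_deriv (\<lambda>x. F (softmax x)) j a\<bar>
      = s $ j * \<bar>\<Sum>k\<in>- I. s $ k * (g $ j - g $ k)\<bar>"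
    using softmax_pos[of a j] assms(4) by (simp add: abs_mult)
  also have "\<bar>\<Sum>k\<in>- I. s $ k * (g $ j - g $ k)\<bar> \<le> (\<Sum>k\<in>- I. \<epsilon> * \<bar>g $ j - g $ k\<bar>)"
  proof (rule order_trans[OF sum_abs], rule sum_mono)
    fix k assume "k \<in> - I"
    \<comment> \<open>Outside \<open>I\<close> the weight is at most \<epsilon>, and positivity
      makes it equal to its absolute value.\<close>
    then show "\<bar>s $ k * (g $ j - g $ k)\<bar> \<le> \<epsilon> * \<bar>g $ j - g $ k\<bar>"
      using softmax_pos[of a k] assms(4,7) by (auto simp: abs_mult intro!: mult_right_mono)
  qed
  finally show "\<bar>partial_deriv (\<lambda>x. F (softmax x)) j a\<bar>
      \<le> \<epsilon> * s $ j * (\<Sum>k\<in>- I. \<bar>g $ j - g $ k\<bar>)"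
    using softmax_pos[of a j] assms(4) by (simp add: sum_distrib_left mult_ac)
qed

end
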